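(* Let $L>0$, $\mu>0$, let $f:\mathbb{R}^d\to\mathbb{R}$ be differentiable with $L$-Lipschitz continuous gradient (not necessarily convex), let $h:\mathbb{R}^d\to\mathbb{R}\cup\{+\infty\}$ be closed, proper and convex, and let $F=f+h$ have a nonempty set of global minimizers, with minimum value $F_*$. Let $\gamma\in(0,\frac2L)$ and $x_1\in\mathbb{R}^d$, and suppose that $F$ satisfies the RPL inequality with constant $\mu$ on $X=\{x:F(x)\le F(x_1)\}$, i.e. $$\|\mathcal{G}_\gamma(x)\|^2\ \ge\ 2\mu\,(F(x)-F_* )\qquad\text{for all }x\in X,$$ where $\mathcal{G}_\gamma(x)=\frac1\gamma\left(x-\mathrm{prox}_{\gamma h}(x-\gamma\nabla f(x))\right)$. Let $x_2=\mathrm{prox}_{\gamma h}(x_1-\gamma\nabla f(x_1))$. Then $$F(x_2)-F_*\le\frac{L+\mu(L\gamma-1)^2-\mu}{L}\,(F(x_1)-F_* ).$$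
   Context: $\|\cdot\|$ is the Euclidean norm on $\mathbb{R}^d$. For a closed proper convex function $g$, $\mathrm{prox}_{g}(x)=\operatorname{argmin}_{y\in\mathbb{R}^d}\{g(y)+\frac12\|y-x\|^2\}$. The parameter $\gamma$ in the residual $\mathcal{G}_\gamma$ is the same as the step size of the proximal gradient step. *)

theory Defs
  imports "HOL-Analysis.Analysis"
begin

text \<open>
  Functions with values in \<open>\<real> \<union> {+\<infinity>}\<close> are represented as functions into \<^typ>\<open>ereal\<close>;
  \<open>proper_fun\<close> excludes the value \<open>-\<infinity>\<close>. Closedness and convexity are those of the epigraph,
  a subset of \<open>\<real>\<^sup>d \<times> \<real>\<close>.
\<close>

definition ereal_epigraph :: "('a \<Rightarrow> ereal) \<Rightarrow> ('a \<times> real) set" where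
  "ereal_epigraph g = {(x, r). g x \<le> ereal r}"

definition proper_fun :: "('a \<Rightarrow> ereal) \<Rightarrow> bool" where
  "proper_fun g \<longleftrightarrow> (\<forall>x. g x \<noteq> -\<infinity>) \<and> (\<exists>x. g x \<noteq> \<infinity>)"

definition closed_fun :: "('a::topological_space \<Rightarrow> ereal) \<Rightarrow> bool" where
  "closed_fun g \<longleftrightarrow> closed (ereal_epigraph g)"

definition convex_fun :: "('a::real_vector \<Rightarrow> ereal) \<Rightarrow> bool" where
  "convex_fun g \<longleftrightarrow> convex (ereal_epigraph g)"

text \<open>
  \<^const>\<open>arg_min\<close> selects some minimizer. For closed proper convex \<open>g\<close> on a Euclidean space the
  minimizer exists and is unique, so the choice is immaterial.
\<close>

definition prox :: "('a::real_normed_vector \<Rightarrow> ereal) \<Rightarrow> 'a \<Rightarrow> 'a" where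
  "prox g x = arg_min (\<lambda>y. g y + ereal (1 / 2 * (norm (y - x))\<^sup>2)) (\<lambda>_. True)"

text \<open>In the next two definitions \<open>f'\<close> is the gradient of the smooth part.\<close>

definition prox_grad_step ::
  "real \<Rightarrow> ('a::real_normed_vector \<Rightarrow> 'a) \<Rightarrow> ('a \<Rightarrow> ereal) \<Rightarrow> 'a \<Rightarrow> 'a" where
  "prox_grad_step \<gamma> f' h x = prox (\<lambda>y. ereal \<gamma> * h y) (x - \<gamma> *\<^sub>R f' x)"

definition prox_grad_residual ::
  "real \<Rightarrow> ('a::real_normed_vector \<Rightarrow> 'a) \<Rightarrow> ('a \<Rightarrow> ereal) \<Rightarrow> 'a \<Rightarrow> 'a" where
  "prox_grad_residual \<gamma> f' h x = (1 / \<gamma>) *\<^sub>R (x - prox_grad_step \<gamma> f' h x)"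

end

theory Submission
  imports Defs
begin

text \<open>
  The argument is one step of proximal gradient descent. Write \<open>G\<close> for the residual at \<open>x1\<close>, so
  that \<open>x2 - x1 = - \<gamma> G\<close>. Optimality of \<open>x2\<close> in the proximal problem says that
  \<open>G - \<nabla>f(x1)\<close> is a subgradient of \<open>h\<close> at \<open>x2\<close> (\<open>prox_subgradient\<close>), whence
  \<open>h(x2) \<le> h(x1) - \<gamma> \<langle>G - \<nabla>f(x1), G\<rangle>\<close>. The quadratic upper bound for a function with Lipschitz
  gradient (\<open>lipschitz_gradient_upper_bound\<close>) gives
  \<open>f(x2) \<le> f(x1) - \<gamma> \<langle>\<nabla>f(x1), G\<rangle> + (L \<gamma>\<^sup>2 / 2) \<parallel>G\<parallel>\<^sup>2\<close>. In the sum the gradient cancels: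
  \<open>F(x2) \<le> F(x1) - \<gamma> (1 - L \<gamma> / 2) \<parallel>G\<parallel>\<^sup>2\<close>.
  The factor \<open>\<gamma> (1 - L \<gamma> / 2)\<close> is positive for \<open>\<gamma> < 2 / L\<close>, so inserting the RPL inequality at
  \<open>x1\<close> yields the contraction factor \<open>1 - \<mu> \<gamma> (2 - L \<gamma>)\<close>, which is the stated one because
  \<open>(L \<gamma> - 1)\<^sup>2 - 1 = - L \<gamma> (2 - L \<gamma>)\<close>.

  The RPL inequality at \<open>x1\<close> bounds the gap by a real number, so it also forces \<open>F(x1) < \<infinity>\<close>, and
  all the inequalities above are between real numbers.

  The remaining analytic point is that the proximal problem has a solution at all
  (\<open>prox_is_minimizer\<close>): a hyperplane separating the epigraph from a point just below it is the
  graph of an affine minorant, the quadratic term dominates that minorant, and the sublevel sets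
  are therefore compact.
\<close>

section \<open>The proximal operator\<close>

lemma ereal_times_le_iff:
  fixes \<gamma> r :: real and a :: ereal
  assumes "\<gamma> > 0"
  shows "ereal \<gamma> * a \<le> ereal r \<longleftrightarrow> a \<le> ereal (r / \<gamma>)"
  using assms by (cases a) (auto simp: field_simps)

lemma ereal_epigraph_scale:
  assumes "\<gamma> > 0"
  shows "ereal_epigraph (\<lambda>x. ereal \<gamma> * h x) = (\<lambda>(x, r). (x, r / \<gamma>)) -` ereal_epigraph h"
  unfolding ereal_epigraph_def using assms by (auto simp: ereal_times_le_iff)

lemma closed_fun_scale:
  fixes h :: "'a::topological_space \<Rightarrow> ereal"
  assumes "\<gamma> > 0" "closed_fun h"
  shows "closed_fun (\<lambda>x. ereal \<gamma> * h x)"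
  unfolding closed_fun_def ereal_epigraph_scale[OF assms(1)]
  using assms by (intro closed_vimage)
    (auto simp: closed_fun_def case_prod_beta intro!: continuous_intros)

lemma convex_fun_scale:
  fixes h :: "'a::real_vector \<Rightarrow> ereal"
  assumes "\<gamma> > 0" "convex_fun h"
  shows "convex_fun (\<lambda>x. ereal \<gamma> * h x)"
proof -
  have "linear (\<lambda>(x::'a, r). (x, r / \<gamma>))"
    by (rule linearI) (auto simp: add_divide_distrib)
  then show ?thesis
    unfolding convex_fun_def ereal_epigraph_scale[OF assms(1)]
    using assms(2) by (auto intro: convex_linear_vimage simp: convex_fun_def)
qed

lemma proper_fun_scale:
  assumes "\<gamma> > 0" "proper_fun h"
  shows "proper_fun (\<lambda>x. ereal \<gamma> * h x)"
  using assms unfolding proper_fun_def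
  by (metis ereal_times(1) ereal_mult_eq_MInfty ereal_mult_eq_PInfty ereal_less(2)
      not_less_iff_gr_or_eq ereal_infty_less(1) PInfty_neq_ereal(1) MInfty_neq_ereal(1))

text \<open>
  The separated point lies strictly below the graph over a point of the effective domain. This
  rules out a vertical hyperplane, so the separating hyperplane can be solved for the last
  coordinate.
\<close>

lemma closed_convex_proper_affine_minorant:
  fixes g :: "'a::euclidean_space \<Rightarrow> ereal"
  assumes "closed_fun g" "proper_fun g" "convex_fun g"
  obtains a c where "\<And>y. ereal (a \<bullet> y + c) \<le> g y"
proof -
  obtain p where "g p \<noteq> \<infinity>" "g p \<noteq> -\<infinity>"
    using assms(2) by (auto simp: proper_fun_def)
  then obtain q where q: "g p = ereal q" by (cases "g p") auto
  have "(p, q - 1) \<notin> ereal_epigraph g"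
    by (simp add: ereal_epigraph_def q)
  then obtain ab d where sep: "ab \<bullet> (p, q - 1) < d" "\<And>z. z \<in> ereal_epigraph g \<Longrightarrow> d < ab \<bullet> z"
    using separating_hyperplane_closed_point[of "ereal_epigraph g" "(p, q - 1)"] assms
    by (metis closed_fun_def convex_fun_def)
  obtain a b where ab: "ab = (a, b)" by fastforce
  have below: "d < a \<bullet> y + b * r" if "g y \<le> ereal r" for y r
    using sep(2)[of "(y, r)"] that by (simp add: ab ereal_epigraph_def)
  have "a \<bullet> p + b * (q - 1) < d"
    using sep(1) by (simp add: ab)
  with below[of p q] have b: "b > 0"
    by (simp add: q algebra_simps)
  show thesis
  proof (rule that)
    fix y
    show "ereal ((- (1 / b) *\<^sub>R a) \<bullet> y + d / b) \<le> g y"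
    proof (cases "g y")
      case (real r)
      with below[of y r] b show ?thesis by (simp add: field_simps)
    qed (use assms(2) in \<open>auto simp: proper_fun_def\<close>)
  qed
qed

lemma prox_is_minimizer:
  fixes g :: "'a::euclidean_space \<Rightarrow> ereal"
  assumes "closed_fun g" "proper_fun g" "convex_fun g"
  shows "g (prox g x) + ereal (1 / 2 * (norm (prox g x - x))\<^sup>2)
           \<le> g z + ereal (1 / 2 * (norm (z - x))\<^sup>2)"
proof -
  define \<phi> where "\<phi> y = g y + ereal (1 / 2 * (norm (y - x))\<^sup>2)" for y
  obtain a c where minorant: "\<And>y. ereal (a \<bullet> y + c) \<le> g y"
    using closed_convex_proper_affine_minorant[OF assms] by blast
  obtain p where "g p \<noteq> \<infinity>" "g p \<noteq> -\<infinity>"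
    using assms(2) by (auto simp: proper_fun_def)
  then obtain r0 where r0: "\<phi> p = ereal r0"
    unfolding \<phi>_def by (cases "g p") auto
  define K where "K = ereal_epigraph \<phi> \<inter> {z. snd z \<le> r0}"
  have epi: "ereal_epigraph \<phi> =
      (\<lambda>z. (fst z, snd z - 1 / 2 * (norm (fst z - x))\<^sup>2)) -` ereal_epigraph g"
  proof -
    have "\<phi> y \<le> ereal r \<longleftrightarrow> g y \<le> ereal (r - 1 / 2 * (norm (y - x))\<^sup>2)" for y r
      unfolding \<phi>_def by (cases "g y") auto
    then show ?thesis by (auto simp: ereal_epigraph_def)
  qed
  have "closed (ereal_epigraph \<phi>)"
    unfolding epi using assms(1)
    by (intro closed_vimage) (auto simp: closed_fun_def intro!: continuous_intros)
  then have "closed K"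
    unfolding K_def by (intro closed_Int closed_Collect_le continuous_intros) auto
  moreover have "bounded K"
  proof -
    \<comment> \<open>Completing the square: the minorant plus the quadratic term is
      \<open>(1 / 2) * (norm (y - x + a))\<^sup>2\<close> up to the constant \<open>l\<close>.\<close>
    define l where "l = a \<bullet> x + c - (norm a)\<^sup>2 / 2"
    have lower: "l + (norm (y - (x - a)))\<^sup>2 / 2 \<le> r" if "\<phi> y \<le> ereal r" for y r
    proof -
      have "ereal (a \<bullet> y + c + 1 / 2 * (norm (y - x))\<^sup>2) \<le> \<phi> y"
        unfolding \<phi>_def using add_right_mono[OF minorant[of y]] by (metis plus_ereal.simps(1))
      then have "a \<bullet> y + c + 1 / 2 * (norm (y - x))\<^sup>2 \<le> r"
        using that by (metis ereal_less_eq(3) order_trans)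
      moreover have "(norm (y - (x - a)))\<^sup>2 = (norm (y - x))\<^sup>2 + 2 * (a \<bullet> y - a \<bullet> x) + (norm a)\<^sup>2"
        unfolding power2_norm_eq_inner
        by (simp add: inner_diff_left inner_diff_right inner_commute)
      ultimately show ?thesis
        unfolding l_def by (simp add: field_simps)
    qed
    have "K \<subseteq> cball (x - a) (sqrt (2 * (r0 - l))) \<times> {l..r0}"
    proof
      fix z assume "z \<in> K"
      then obtain y r where z: "z = (y, r)" "\<phi> y \<le> ereal r" "r \<le> r0"
        unfolding K_def ereal_epigraph_def by auto
      have "(norm (y - (x - a)))\<^sup>2 \<le> 2 * (r0 - l)"
        using lower[OF z(2)] z(3) by simp
      then have "norm (y - (x - a)) \<le> sqrt (2 * (r0 - l))"
        by (rule real_le_rsqrt)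
      moreover have "l \<le> r"
        using lower[OF z(2)] zero_le_power2[of "norm (y - (x - a))"] by linarith
      ultimately show "z \<in> cball (x - a) (sqrt (2 * (r0 - l))) \<times> {l..r0}"
        using z by (simp add: dist_norm norm_minus_commute)
    qed
    then show ?thesis
      by (rule bounded_subset[rotated]) (intro bounded_Times bounded_cball bounded_closed_interval)
  qed
  ultimately have "compact K" by (simp add: compact_eq_bounded_closed)
  moreover have "(p, r0) \<in> K" by (simp add: K_def ereal_epigraph_def r0)
  ultimately obtain w where w: "w \<in> K" "\<And>z. z \<in> K \<Longrightarrow> snd w \<le> snd z"
    using continuous_attains_inf[of K snd] by (force intro: continuous_intros)
  have "\<phi> (fst w) \<le> \<phi> y" for y
  proof (cases "\<phi> y \<le> ereal r0")
    case True
    have w': "\<phi> (fst w) \<le> ereal (snd w)"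
      using w(1) by (auto simp: K_def ereal_epigraph_def)
    from True show ?thesis
    proof (cases "\<phi> y")
      case (real s)
      then have "(y, s) \<in> K" using True by (simp add: K_def ereal_epigraph_def)
      then show ?thesis using w(2) w' real by (force intro: order_trans)
    next
      case MInf
      then have "g y = -\<infinity>" unfolding \<phi>_def by (cases "g y") auto
      then show ?thesis using assms(2) by (simp add: proper_fun_def)
    qed auto
  next
    case False
    moreover have "\<phi> (fst w) \<le> ereal r0"
      using w(1) by (auto simp: K_def ereal_epigraph_def intro: order_trans)
    ultimately show ?thesis by (meson linear order_trans)
  qed
  then have "is_arg_min \<phi> (\<lambda>_. True) (fst w)"
    by (simp add: is_arg_min_linorder)
  moreover have "prox g x = arg_min \<phi> (\<lambda>_. True)"
    unfolding prox_def \<phi>_def ..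
  ultimately have "is_arg_min \<phi> (\<lambda>_. True) (prox g x)"
    unfolding arg_min_def by (metis someI)
  then show ?thesis by (simp add: is_arg_min_linorder \<phi>_def)
qed

lemma prox_finite:
  fixes g :: "'a::euclidean_space \<Rightarrow> ereal"
  assumes "closed_fun g" "proper_fun g" "convex_fun g"
  shows "\<bar>g (prox g x)\<bar> \<noteq> \<infinity>"
proof -
  obtain p where "g p \<noteq> \<infinity>"
    using assms(2) by (auto simp: proper_fun_def)
  with prox_is_minimizer[OF assms, of x p] have "g (prox g x) \<noteq> \<infinity>" by auto
  with assms(2) show ?thesis by (auto simp: proper_fun_def)
qed

lemma convex_fun_segment_le:
  fixes g :: "'a::real_vector \<Rightarrow> ereal"
  assumes "convex_fun g" "g u \<le> ereal a" "g v \<le> ereal b" "0 \<le> t" "t \<le> 1"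
  shows "g (u + t *\<^sub>R (v - u)) \<le> ereal (a + t * (b - a))"
proof -
  have "(1 - t) *\<^sub>R (u, a) + t *\<^sub>R (v, b) \<in> ereal_epigraph g"
    using assms by (intro convexD_alt) (auto simp: convex_fun_def ereal_epigraph_def)
  then show ?thesis by (simp add: ereal_epigraph_def algebra_simps)
qed

text \<open>
  Moving from the minimizer towards \<open>z\<close> by a fraction \<open>t\<close> changes \<open>g\<close> by at most \<open>t (g z - g p)\<close>
  and the quadratic term by \<open>t \<langle>p - x, z - p\<rangle> + O(t\<^sup>2)\<close>; the total change is nonnegative, and
  the claim is its first-order part as \<open>t\<close> tends to \<open>0\<close>.
\<close>

lemma prox_subgradient:
  fixes g :: "'a::euclidean_space \<Rightarrow> ereal"
  assumes "closed_fun g" "proper_fun g" "convex_fun g"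
  shows "g (prox g x) + ereal ((x - prox g x) \<bullet> (z - prox g x)) \<le> g z"
proof -
  define p where "p = prox g x"
  obtain q where q: "g p = ereal q"
    using prox_finite[OF assms, of x] unfolding p_def by (cases "g (prox g x)") auto
  show ?thesis
  proof (cases "g z")
    case (real b)
    define D where "D = (norm (z - p))\<^sup>2 / 2"
    have approx: "q - b + (x - p) \<bullet> (z - p) \<le> t * D" if t: "0 < t" "t < 1" for t :: real
    proof -
      define w where "w = p + t *\<^sub>R (z - p)"
      have "ereal (q + 1 / 2 * (norm (p - x))\<^sup>2) \<le> g w + ereal (1 / 2 * (norm (w - x))\<^sup>2)"
        using prox_is_minimizer[OF assms, of x w] by (simp add: p_def[symmetric] q)
      also have "\<dots> \<le> ereal (q + t * (b - q)) + ereal (1 / 2 * (norm (w - x))\<^sup>2)"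
        unfolding w_def using t q real by (intro add_right_mono convex_fun_segment_le assms) auto
      finally have "1 / 2 * (norm (p - x))\<^sup>2 \<le> t * (b - q) + 1 / 2 * (norm (w - x))\<^sup>2"
        by simp
      moreover have "(norm (w - x))\<^sup>2 =
          (norm (p - x))\<^sup>2 + 2 * (t * ((p - x) \<bullet> (z - p))) + t\<^sup>2 * (norm (z - p))\<^sup>2"
      proof -
        have "w - x = (p - x) + t *\<^sub>R (z - p)" by (simp add: w_def)
        then show ?thesis
          unfolding power2_norm_eq_inner
          by (simp only: inner_add_left inner_add_right inner_scaleR_left inner_scaleR_right)
             (simp add: inner_commute power2_eq_square algebra_simps)
      qed
      ultimately have "0 \<le> t * (b - q) + t * ((p - x) \<bullet> (z - p)) + t * (t * D)"
        by (simp add: D_def power2_eq_square)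
      then have "0 \<le> t * ((b - q) + (p - x) \<bullet> (z - p) + t * D)"
        by (simp add: algebra_simps)
      then have "0 \<le> (b - q) + (p - x) \<bullet> (z - p) + t * D"
        using t by (simp add: zero_le_mult_iff)
      moreover have "(x - p) \<bullet> (z - p) = - ((p - x) \<bullet> (z - p))"
        by (simp add: inner_diff_left)
      ultimately show ?thesis by simp
    qed
    have "((\<lambda>t. t * D) \<longlongrightarrow> 0 * D) (at_right 0)"
      by (intro tendsto_intros)
    then have "q - b + (x - p) \<bullet> (z - p) \<le> 0 * D"
    proof (rule tendsto_lowerbound)
      show "\<forall>\<^sub>F t in at_right 0. q - b + (x - p) \<bullet> (z - p) \<le> t * D"
        using approx by (intro eventually_at_rightI[of 0 1]) auto
    qed simp
    then show ?thesis by (simp add: p_def[symmetric] q real)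
  qed (use assms(2) in \<open>auto simp: proper_fun_def\<close>)
qed

section \<open>Descent of the proximal gradient step\<close>

text \<open>
  Along the segment from \<open>x\<close> to \<open>y\<close>, the difference of the two sides has nonpositive derivative, by
  the Cauchy-Schwarz inequality and the Lipschitz bound on the gradient.
\<close>

lemma lipschitz_gradient_upper_bound:
  fixes f :: "'a::real_inner \<Rightarrow> real"
  assumes "\<And>x. GDERIV f x :> f' x" "L-lipschitz_on UNIV f'"
  shows "f y \<le> f x + f' x \<bullet> (y - x) + L / 2 * (norm (y - x))\<^sup>2"
proof -
  define d where "d = y - x"
  define \<psi> where "\<psi> t = f (x + t *\<^sub>R d) - t * (f' x \<bullet> d) - L / 2 * t\<^sup>2 * (norm d)\<^sup>2" for t
  have "\<psi> 1 \<le> \<psi> 0"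
  proof (rule DERIV_nonpos_imp_nonincreasing[of 0 1 \<psi>])
    fix t :: real
    assume t: "0 \<le> t"
    have f_deriv: "((\<lambda>t. f (x + t *\<^sub>R d)) has_derivative (\<lambda>s. (s *\<^sub>R d) \<bullet> f' (x + t *\<^sub>R d))) (at t)"
      by (rule has_derivative_compose[of "\<lambda>t. x + t *\<^sub>R d" _ t UNIV f])
         (use assms(1) in \<open>auto simp: gderiv_def intro!: derivative_eq_intros\<close>)
    have "((\<lambda>t. f (x + t *\<^sub>R d)) has_real_derivative f' (x + t *\<^sub>R d) \<bullet> d) (at t)"
      unfolding has_field_derivative_def
      by (rule has_derivative_eq_rhs[OF f_deriv]) (auto simp: inner_commute)
    then have "(\<psi> has_real_derivative
        f' (x + t *\<^sub>R d) \<bullet> d - f' x \<bullet> d - L * t * (norm d)\<^sup>2) (at t)"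
      unfolding \<psi>_def by (auto intro!: derivative_eq_intros)
    moreover have "f' (x + t *\<^sub>R d) \<bullet> d - f' x \<bullet> d \<le> L * t * (norm d)\<^sup>2"
    proof -
      have "f' (x + t *\<^sub>R d) \<bullet> d - f' x \<bullet> d \<le> norm (f' (x + t *\<^sub>R d) - f' x) * norm d"
        using norm_cauchy_schwarz by (metis inner_diff_left)
      also have "norm (f' (x + t *\<^sub>R d) - f' x) \<le> L * norm (t *\<^sub>R d)"
        using lipschitz_onD[OF assms(2), of "x + t *\<^sub>R d" x] by (simp add: dist_norm)
      finally show ?thesis
        using t by (simp add: mult_right_mono power2_eq_square mult.assoc)
    qed
    ultimately show "\<exists>D. (\<psi> has_real_derivative D) (at t) \<and> D \<le> 0"
      by (intro exI conjI) auto
  qed simp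
  then show ?thesis by (simp add: \<psi>_def d_def)
qed

lemma prox_grad_step_descent:
  fixes f :: "'a::euclidean_space \<Rightarrow> real"
  assumes f: "\<And>x. GDERIV f x :> f' x" "L-lipschitz_on UNIV f'"
    and h: "closed_fun h" "proper_fun h" "convex_fun h"
    and "\<gamma> > 0" "h x = ereal a"
  obtains b where "h (prox_grad_step \<gamma> f' h x) = ereal b"
    and "f (prox_grad_step \<gamma> f' h x) + b
           \<le> f x + a - \<gamma> * (1 - L * \<gamma> / 2) * (norm (prox_grad_residual \<gamma> f' h x))\<^sup>2"
proof -
  define y where "y = prox_grad_step \<gamma> f' h x"
  define G where "G = prox_grad_residual \<gamma> f' h x"
  have y: "y = prox (\<lambda>y. ereal \<gamma> * h y) (x - \<gamma> *\<^sub>R f' x)"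
    by (simp add: y_def prox_grad_step_def)
  have step: "y - x = - (\<gamma> *\<^sub>R G)"
    using \<open>\<gamma> > 0\<close> by (simp add: G_def prox_grad_residual_def y_def)
  note scaled = closed_fun_scale[OF \<open>\<gamma> > 0\<close> h(1)] proper_fun_scale[OF \<open>\<gamma> > 0\<close> h(2)]
    convex_fun_scale[OF \<open>\<gamma> > 0\<close> h(3)]
  obtain b where b: "h y = ereal b"
    using prox_finite[OF scaled, of "x - \<gamma> *\<^sub>R f' x"] \<open>\<gamma> > 0\<close> unfolding y[symmetric]
    by (cases "h y") auto
  have "\<gamma> * b + (x - \<gamma> *\<^sub>R f' x - y) \<bullet> (x - y) \<le> \<gamma> * a"
    using prox_subgradient[OF scaled, of "x - \<gamma> *\<^sub>R f' x" x] \<open>h x = ereal a\<close>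
    unfolding y[symmetric] by (simp add: b)
  moreover have "x - y = \<gamma> *\<^sub>R G" "x - \<gamma> *\<^sub>R f' x - y = \<gamma> *\<^sub>R (G - f' x)"
    using step by (simp_all add: algebra_simps)
  ultimately have "\<gamma> * (b + \<gamma> * ((G - f' x) \<bullet> G)) \<le> \<gamma> * a"
    by (simp add: algebra_simps)
  then have "b + \<gamma> * ((G - f' x) \<bullet> G) \<le> a"
    using \<open>\<gamma> > 0\<close> by simp
  then have "b \<le> a - \<gamma> * (norm G)\<^sup>2 + \<gamma> * (f' x \<bullet> G)"
    by (simp add: power2_norm_eq_inner algebra_simps)
  moreover have "f y \<le> f x - \<gamma> * (f' x \<bullet> G) + L / 2 * (\<gamma>\<^sup>2 * (norm G)\<^sup>2)"
    using lipschitz_gradient_upper_bound[OF f, of y x] by (simp add: step power_mult_distrib)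
  ultimately have "f y + b \<le> f x + a - \<gamma> * (1 - L * \<gamma> / 2) * (norm G)\<^sup>2"
    by (simp add: algebra_simps power2_eq_square)
  with b show thesis by (intro that) (auto simp: y_def G_def)
qed

theorem theorem5:
  fixes f :: "real ^ 'n \<Rightarrow> real"
    and f' :: "real ^ 'n \<Rightarrow> real ^ 'n"
    and h F :: "real ^ 'n \<Rightarrow> ereal"
    and Fstar :: ereal
    and L \<mu> \<gamma> :: real
    and xstar x1 x2 :: "real ^ 'n"
  assumes "L > 0" and "\<mu> > 0"
    and "\<And>x. GDERIV f x :> f' x"
    and "L-lipschitz_on UNIV f'"
    and "closed_fun h" and "proper_fun h" and "convex_fun h"
    and "F = (\<lambda>x. ereal (f x) + h x)"
    and "is_arg_min F (\<lambda>_. True) xstar" and "Fstar = F xstar"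
    and "0 < \<gamma>" and "\<gamma> < 2 / L"
    and "\<And>x. F x \<le> F x1 \<Longrightarrow>
           ereal ((norm (prox_grad_residual \<gamma> f' h x))\<^sup>2) \<ge> ereal (2 * \<mu>) * (F x - Fstar)"
    and "x2 = prox_grad_step \<gamma> f' h x1"
  shows "F x2 - Fstar \<le> ereal ((L + \<mu> * (L * \<gamma> - 1)\<^sup>2 - \<mu>) / L) * (F x1 - Fstar)"
proof -
  define N where "N = (norm (prox_grad_residual \<gamma> f' h x1))\<^sup>2"
  have rpl: "ereal (2 * \<mu>) * (F x1 - Fstar) \<le> ereal N"
    using assms(13)[of x1] by (simp add: N_def)
  have h_bot: "h x \<noteq> -\<infinity>" for x
    using \<open>proper_fun h\<close> by (simp add: proper_fun_def)
  \<comment> \<open>An infinite value at \<open>x1\<close> would make the left-hand side of \<open>rpl\<close> infinite.\<close>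
  have "h x1 \<noteq> \<infinity>"
  proof
    assume "h x1 = \<infinity>"
    then have "F x1 - Fstar = \<infinity>" by (simp add: assms(8))
    with rpl \<open>\<mu> > 0\<close> show False by simp
  qed
  with h_bot obtain a where a: "h x1 = ereal a" by (cases "h x1") auto
  have "F xstar \<le> F x1"
    using assms(9) by (simp add: is_arg_min_linorder)
  then have "h xstar \<noteq> \<infinity>"
    by (auto simp: assms(8) a)
  with h_bot obtain s where "h xstar = ereal s" by (cases "h xstar") auto
  then obtain m where m: "Fstar = ereal m"
    by (simp add: assms(8,10))
  obtain b where b: "h x2 = ereal b"
    and descent: "f x2 + b \<le> f x1 + a - \<gamma> * (1 - L * \<gamma> / 2) * N"
    using prox_grad_step_descent[OF assms(3-7) \<open>0 < \<gamma>\<close> a] unfolding assms(14) N_def by blast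
  have "2 * \<mu> * (f x1 + a - m) \<le> N"
    using rpl by (simp add: assms(8) a m)
  moreover have "0 \<le> \<gamma> * (1 - L * \<gamma> / 2)"
    using \<open>L > 0\<close> \<open>0 < \<gamma>\<close> \<open>\<gamma> < 2 / L\<close> by (simp add: field_simps)
  ultimately have "\<gamma> * (1 - L * \<gamma> / 2) * (2 * \<mu> * (f x1 + a - m)) \<le> \<gamma> * (1 - L * \<gamma> / 2) * N"
    by (rule mult_left_mono)
  with descent have
    "f x2 + b - m \<le> (f x1 + a - m) - \<gamma> * (1 - L * \<gamma> / 2) * (2 * \<mu> * (f x1 + a - m))"
    by linarith
  also have "\<dots> = (L + \<mu> * (L * \<gamma> - 1)\<^sup>2 - \<mu>) / L * (f x1 + a - m)"
    using \<open>L > 0\<close> by (simp add: field_simps power2_eq_square)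
  finally show ?thesis
    by (simp add: assms(8) a b m)
qed

end
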